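(* Let $S$ be a complete (possibly killed) subordinator whose Laplace exponent $\phi$ satisfies the following: there exist $\alpha\in(0,2)$ and a measurable function $\ell:(0,\infty)\to(0,\infty)$, locally bounded above and below by positive constants and slowly varying at infinity, such that $\phi(\lambda)\asymp\lambda^{\alpha/2}\ell(\lambda)$ as $\lambda\to\infty$. Then the potential density $u$ of $S$ satisfies $$u(t)\asymp t^{-1}\phi(t^{-1})^{-1}\asymp\frac{t^{\alpha/2-1}}{\ell(t^{-1})},\qquad t\to0+.$$
   Context: A $C^\infty$ function $\phi:(0,\infty)\to[0,\infty)$ is a Bernstein function if $(-1)^nD^n\phi\le 0$ for every $n\ge1$; equivalently $\phi(\lambda)=a+b\lambda+\int_{(0,\infty)}(1-e^{-\lambda t})\,\mu(dt)$ with $a,b\ge0$ (killing coefficient, drift) and a measure $\mu$ (Lévy measure) with $\int(1\wedge t)\,\mu(dt)<\infty$. It is a complete Bernstein function if $\mu$ has a completely monotone density. A (possibly killed) subordinator is an increasing Lévy process on $[0,\infty)$ started at $0$, possibly sent to $\infty$ at an independent exponential time; its Laplace exponent $\phi$ is defined by $\mathbb E[e^{-\lambda S_t}]=e^{-t\phi(\lambda)}$, $\lambda>0$ (with $e^{-\lambda\infty}=0$), and it is a Bernstein function. The subordinator is called complete if $\phi$ is a complete Bernstein function. Standing assumptions: $S$ has no drift and $\lim_{\lambda\to\infty}\phi(\lambda)=\infty$. Then the potential measure $U(A)=\mathbb E\int_0^\infty \mathbf 1_{\{S_t\in A\}}\,dt$ has a completely monotone density $u$ on $(0,\infty)$, called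 the potential density. A function $\ell:(0,\infty)\to(0,\infty)$ is slowly varying at infinity if $\lim_{t\to\infty}\ell(\lambda t)/\ell(t)=1$ for every $\lambda>0$. Convention: $f(\lambda)\asymp g(\lambda)$ as $\lambda\to\infty$ (resp. $f(t)\asymp g(t)$ as $t\to0+$) means there is a constant $c>1$ with $c^{-1}\le f/g\le c$ on $[1,\infty)$ (resp. on $(0,1]$). *)

theory Defs
  imports "HOL-Probability.Probability"
begin

text \<open>
  Functions on \<open>(0, \<infinity>)\<close> are total functions on the reals of which only the restriction to
  \<open>{0<..}\<close> matters. As \<open>{0<..}\<close> is open, iterated derivatives at its points do not depend on the
  values outside.
\<close>

section \<open>Completely monotone and Bernstein functions\<close>

definition smooth_on_pos :: "(real \<Rightarrow> real) \<Rightarrow> bool" where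
  "smooth_on_pos f \<longleftrightarrow> (\<forall>n. (deriv ^^ n) f differentiable_on {0<..})"

definition completely_monotone :: "(real \<Rightarrow> real) \<Rightarrow> bool" where
  "completely_monotone f \<longleftrightarrow>
     smooth_on_pos f \<and> (\<forall>n. \<forall>x>0. 0 \<le> (-1) ^ n * (deriv ^^ n) f x)"

definition bernstein_function :: "(real \<Rightarrow> real) \<Rightarrow> bool" where
  "bernstein_function \<phi> \<longleftrightarrow>
     smooth_on_pos \<phi> \<and> (\<forall>x>0. 0 \<le> \<phi> x) \<and> (\<forall>n\<ge>1. \<forall>x>0. (-1) ^ n * (deriv ^^ n) \<phi> x \<le> 0)"

definition levy_measure :: "real measure \<Rightarrow> bool" where
  "levy_measure \<mu> \<longleftrightarrow>
     sets \<mu> = sets borel \<and> emeasure \<mu> {..0} = 0 \<and> (\<integral>\<^sup>+t. ennreal (min 1 t) \<partial>\<mu>) < \<infinity>"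

text \<open>Killing coefficient \<open>a\<close>, drift \<open>b\<close> and Levy measure \<open>\<mu>\<close> of \<open>\<phi>\<close>.\<close>

definition levy_triplet :: "(real \<Rightarrow> real) \<Rightarrow> real \<Rightarrow> real \<Rightarrow> real measure \<Rightarrow> bool" where
  "levy_triplet \<phi> a b \<mu> \<longleftrightarrow>
     0 \<le> a \<and> 0 \<le> b \<and> levy_measure \<mu> \<and>
     (\<forall>x>0. \<phi> x = a + b * x + (\<integral>t. (1 - exp (- x * t)) \<partial>\<mu>))"

definition complete_bernstein_function :: "(real \<Rightarrow> real) \<Rightarrow> bool" where
  "complete_bernstein_function \<phi> \<longleftrightarrow>
     bernstein_function \<phi> \<and>
     (\<exists>a b \<mu> m. levy_triplet \<phi> a b \<mu> \<and> completely_monotone m \<and>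
        \<mu> = density lborel (\<lambda>t. ennreal (indicator {0<..} t * m t)))"

definition no_drift :: "(real \<Rightarrow> real) \<Rightarrow> bool" where
  "no_drift \<phi> \<longleftrightarrow> (\<exists>a \<mu>. levy_triplet \<phi> a 0 \<mu>)"

section \<open>Subordinators\<close>

text \<open>Processes are indexed by all reals, but only times \<open>t \<ge> 0\<close> are used.\<close>

definition levy_process :: "'a measure \<Rightarrow> (real \<Rightarrow> 'a \<Rightarrow> real) \<Rightarrow> bool" where
  "levy_process M X \<longleftrightarrow>
     prob_space M \<and>
     (\<forall>t\<ge>0. X t \<in> borel_measurable M) \<and>
     (AE \<omega> in M. X 0 \<omega> = 0) \<and>
     (\<forall>(n::nat) (\<tau>::nat \<Rightarrow> real). 0 \<le> \<tau> 0 \<longrightarrow> mono \<tau> \<longrightarrow>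
        prob_space.indep_vars M (\<lambda>_. borel) (\<lambda>i \<omega>. X (\<tau> (Suc i)) \<omega> - X (\<tau> i) \<omega>) {..<n}) \<and>
     (\<forall>s\<ge>0. \<forall>t\<ge>0. distr M borel (\<lambda>\<omega>. X (s + t) \<omega> - X s \<omega>) = distr M borel (X t)) \<and>
     (AE \<omega> in M. (\<forall>t\<ge>0. continuous (at_right t) (\<lambda>s. X s \<omega>)) \<and>
                 (\<forall>t>0. \<exists>l. ((\<lambda>s. X s \<omega>) \<longlongrightarrow> l) (at_left t)))"

definition subordinator :: "'a measure \<Rightarrow> (real \<Rightarrow> 'a \<Rightarrow> real) \<Rightarrow> bool" where
  "subordinator M X \<longleftrightarrow> levy_process M X \<and> (AE \<omega> in M. mono_on {0..} (\<lambda>t. X t \<omega>))"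

text \<open>
  A random time \<open>\<zeta>\<close> with \<open>P(\<zeta> > t) = exp (- q t)\<close>: exponentially distributed with rate \<open>q\<close> if
  \<open>q > 0\<close>, and almost surely infinite (no killing) if \<open>q = 0\<close>.
\<close>

definition killing_time :: "'a measure \<Rightarrow> real \<Rightarrow> ('a \<Rightarrow> ennreal) \<Rightarrow> bool" where
  "killing_time M q \<zeta> \<longleftrightarrow>
     0 \<le> q \<and> \<zeta> \<in> borel_measurable M \<and>
     (\<forall>t\<ge>0. measure M {\<omega> \<in> space M. ennreal t < \<zeta> \<omega>} = exp (- q * t))"

definition possibly_killed_subordinator :: "'a measure \<Rightarrow> (real \<Rightarrow> 'a \<Rightarrow> ennreal) \<Rightarrow> bool" where
  "possibly_killed_subordinator M S \<longleftrightarrow>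
     (\<forall>t\<ge>0. S t \<in> borel_measurable M) \<and>
     (\<exists>X \<zeta> q. subordinator M X \<and> killing_time M q \<zeta> \<and>
        prob_space.indep_set M
          (sets (vimage_algebra (space M) (\<lambda>\<omega>. \<lambda>t\<in>{0..}. X t \<omega>) (PiM {0..} (\<lambda>_. borel))))
          (sets (vimage_algebra (space M) \<zeta> borel)) \<and>
        (AE \<omega> in M. \<forall>t\<ge>0. S t \<omega> = (if ennreal t < \<zeta> \<omega> then ennreal (X t \<omega>) else \<infinity>)))"

text \<open>\<open>exp (- x y)\<close> for \<open>y \<in> [0, \<infinity>]\<close> and \<open>x > 0\<close>, with \<open>exp (- x \<infinity>) = 0\<close>.\<close>

definition exp_neg_mult :: "real \<Rightarrow> ennreal \<Rightarrow> real" where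
  "exp_neg_mult x y = (if y = \<infinity> then 0 else exp (- x * enn2real y))"

definition laplace_exponent ::
  "'a measure \<Rightarrow> (real \<Rightarrow> 'a \<Rightarrow> ennreal) \<Rightarrow> (real \<Rightarrow> real) \<Rightarrow> bool" where
  "laplace_exponent M S \<phi> \<longleftrightarrow>
     (\<forall>t\<ge>0. \<forall>x>0. (\<integral>\<omega>. exp_neg_mult x (S t \<omega>) \<partial>M) = exp (- t * \<phi> x))"

text \<open>The potential measure on Borel subsets of \<open>[0, \<infinity>)\<close>; the state \<open>\<infinity>\<close> is not counted.\<close>

definition potential_measure ::
  "'a measure \<Rightarrow> (real \<Rightarrow> 'a \<Rightarrow> ennreal) \<Rightarrow> real set \<Rightarrow> ennreal" where
  "potential_measure M S A =
     (\<integral>\<^sup>+\<omega>. (\<integral>\<^sup>+t\<in>{0..}. (if S t \<omega> \<noteq> \<infinity> \<and> enn2real (S t \<omega>) \<in> A then 1 else 0) \<partial>lborel) \<partial>M)"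

text \<open>
  Complete monotonicity selects, among the almost everywhere equal densities of the potential
  measure on \<open>(0, \<infinity>)\<close>, the only continuous one.
\<close>

definition potential_density ::
  "'a measure \<Rightarrow> (real \<Rightarrow> 'a \<Rightarrow> ennreal) \<Rightarrow> (real \<Rightarrow> real) \<Rightarrow> bool" where
  "potential_density M S u \<longleftrightarrow>
     completely_monotone u \<and>
     (\<forall>A\<in>sets borel. A \<subseteq> {0<..} \<longrightarrow>
        potential_measure M S A = (\<integral>\<^sup>+x\<in>A. ennreal (u x) \<partial>lborel))"

section \<open>Asymptotics\<close>

definition slowly_varying :: "(real \<Rightarrow> real) \<Rightarrow> bool" where
  "slowly_varying l \<longleftrightarrow> (\<forall>c>0. ((\<lambda>t. l (c * t) / l t) \<longlongrightarrow> 1) at_top)"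

definition locally_bounded_above_below :: "(real \<Rightarrow> real) \<Rightarrow> bool" where
  "locally_bounded_above_below l \<longleftrightarrow>
     (\<forall>K. compact K \<longrightarrow> K \<subseteq> {0<..} \<longrightarrow> (\<exists>c>0. \<exists>C>0. \<forall>t\<in>K. c \<le> l t \<and> l t \<le> C))"

definition comparable_on :: "real set \<Rightarrow> (real \<Rightarrow> real) \<Rightarrow> (real \<Rightarrow> real) \<Rightarrow> bool" where
  "comparable_on A f g \<longleftrightarrow> (\<exists>c>1. \<forall>x\<in>A. inverse c \<le> f x / g x \<and> f x / g x \<le> c)"

abbreviation comparable_at_infinity :: "(real \<Rightarrow> real) \<Rightarrow> (real \<Rightarrow> real) \<Rightarrow> bool" where
  "comparable_at_infinity \<equiv> comparable_on {1..}"

abbreviation comparable_at_zero :: "(real \<Rightarrow> real) \<Rightarrow> (real \<Rightarrow> real) \<Rightarrow> bool" where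
  "comparable_at_zero \<equiv> comparable_on {0<..1}"

end

theory Submission
  imports Defs
begin

text \<open>
  The potential density \<open>u\<close> is decreasing and its Laplace transform is \<open>1 / \<phi>\<close>
  (\<open>laplace_transform_potential_density\<close>). The theorem is therefore a Tauberian estimate for decreasing
  functions, and both halves are elementary.

  Upper bound: \<open>1 / \<phi> (1 / t)\<close> is at least the integral of \<open>exp (- s / t) * u s\<close> over \<open>(0, t]\<close>, which
  is at least \<open>exp (- 1) * t * u t\<close>.

  Lower bound: splitting the transform, evaluated at \<open>d / t\<close>, into the parts before and after \<open>t\<close> yields
  \<open>1 / \<phi> (d / t) \<le> exp 1 / \<phi> (1 / t) + t * u t / d\<close>. Because \<open>\<phi>\<close> is comparable to a regularly varying
  function of positive index, a small fixed \<open>d\<close> makes \<open>1 / \<phi> (d / t)\<close> at least \<open>2 * exp 1 / \<phi> (1 / t)\<close> for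
  all small \<open>t\<close> (\<open>regularly_varying_small_ratio\<close>), and then \<open>t * u t\<close> is at least a constant times
  \<open>1 / \<phi> (1 / t)\<close>.

  There remain the \<open>t \<le> 1\<close> that are bounded away from \<open>0\<close>. On these \<open>\<phi> (1 / t)\<close> is bounded below, as \<open>l\<close>
  is, and \<open>u t \<ge> u 1\<close>. The value \<open>u 1\<close> is positive since a completely monotone function that vanishes
  at one point vanishes identically (\<open>completely_monotone_pos\<close>), whereas the transform of \<open>u\<close> is not
  zero.

  The second comparison is the hypothesis on \<open>\<phi>\<close> at the point \<open>1 / t\<close>, inverted.
\<close>

section \<open>Completely monotone functions\<close>

lemma completely_monotone_has_derivative:
  assumes "completely_monotone f" "0 < x"
  shows "((\<lambda>x. (-1) ^ n * (deriv ^^ n) f x) has_real_derivative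
           - ((-1) ^ Suc n * (deriv ^^ Suc n) f x)) (at x)"
proof -
  have "(deriv ^^ n) f differentiable_on {0<..}"
    using assms by (auto simp: completely_monotone_def smooth_on_pos_def)
  then have "(deriv ^^ n) f differentiable (at x)"
    using assms(2) by (simp add: differentiable_on_eq_differentiable_at)
  then have "((deriv ^^ n) f has_real_derivative deriv ((deriv ^^ n) f) x) (at x)"
    by (simp add: DERIV_deriv_iff_real_differentiable)
  then show ?thesis
    by (auto intro!: derivative_eq_intros)
qed

lemma completely_monotone_nonneg:
  "completely_monotone f \<Longrightarrow> 0 < x \<Longrightarrow> 0 \<le> f x"
  unfolding completely_monotone_def by (metis funpow_0 mult_1 power_0)

lemma completely_monotone_antimono:
  assumes "completely_monotone f" "0 < x" "x \<le> y"
  shows "f y \<le> f x"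
proof (rule DERIV_nonpos_imp_nonincreasing[OF assms(3)])
  fix z assume "x \<le> z" "z \<le> y"
  then show "\<exists>d. DERIV f z :> d \<and> d \<le> 0"
    using completely_monotone_has_derivative[OF assms(1), of z 0] assms
    by (intro exI[of _ "deriv f z"]) (force simp: completely_monotone_def dest: spec[of _ 1])
qed

text \<open>
  A completely monotone function cannot reach zero to infinite order. Here \<open>g k\<close> stands for
  \<open>(-1) ^ k\<close> times the \<open>k\<close>-th derivative of \<open>g 0\<close>. If
  \<open>n * g (k + 1) y \<le> (b - y) * g (k + 2) y\<close> for all \<open>y \<le> b\<close>, then
  \<open>(b - y) * g (k + 1) y - (n + 1) * g k y\<close> is decreasing in \<open>y\<close>, and it vanishes at \<open>b\<close>, so it is
  nonnegative before. Induction on \<open>n\<close> thus yields \<open>n * g 0 x \<le> (b - x) * g 1 x\<close> for every \<open>n\<close>,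
  which is only possible if \<open>g 0 x = 0\<close>.
\<close>

lemma alternating_derivatives_flat_imp_zero:
  fixes g :: "nat \<Rightarrow> real \<Rightarrow> real"
  assumes deriv: "\<And>k x. 0 < x \<Longrightarrow> (g k has_real_derivative - g (Suc k) x) (at x)"
    and nonneg: "\<And>k x. 0 < x \<Longrightarrow> 0 \<le> g k x"
    and flat: "\<And>k. g k b = 0"
    and x: "0 < x" "x \<le> b"
  shows "g 0 x = 0"
proof -
  have growth: "real n * g k x \<le> (b - x) * g (Suc k) x" if "0 < x" "x \<le> b" for n k x
    using that
  proof (induction n arbitrary: k x)
    case 0
    then show ?case using nonneg by simp
  next
    case (Suc n)
    define h where "h = (\<lambda>y. (b - y) * g (Suc k) y - real (Suc n) * g k y)"
    have "h b \<le> h x"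
    proof (rule DERIV_nonpos_imp_nonincreasing[OF Suc.prems(2)])
      fix y assume y: "x \<le> y" "y \<le> b"
      have "(h has_real_derivative real n * g (Suc k) y - (b - y) * g (Suc (Suc k)) y) (at y)"
        unfolding h_def using y Suc.prems
        by (auto intro!: derivative_eq_intros deriv simp: algebra_simps)
      moreover have "real n * g (Suc k) y \<le> (b - y) * g (Suc (Suc k)) y"
        using Suc y by auto
      ultimately show "\<exists>d. DERIV h y :> d \<and> d \<le> 0" by force
    qed
    then show ?case by (simp add: h_def flat)
  qed
  show ?thesis
  proof (rule ccontr)
    assume "g 0 x \<noteq> 0"
    then have "0 < g 0 x" using nonneg[of x 0] x by simp
    then obtain n where "(b - x) * g 1 x < real n * g 0 x"
      using reals_Archimedean3 by blast
    then show False using growth[OF x, of n 0] by simp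
  qed
qed

text \<open>
  Once a completely monotone function vanishes at a point, it vanishes from there on by
  monotonicity, so it is flat at every later point \<open>b\<close> and therefore zero before \<open>b\<close> as well.
\<close>

lemma completely_monotone_pos:
  assumes cm: "completely_monotone f" and x: "0 < x" "0 < f x" and y: "0 < y"
  shows "0 < f y"
proof (rule ccontr)
  assume "\<not> 0 < f y"
  then have zero: "f z = 0" if "y \<le> z" for z
    using that completely_monotone_antimono[OF cm y that] completely_monotone_nonneg[OF cm, of z] y
    by linarith
  have derivs: "(deriv ^^ k) f z = 0" if "y < z" for k z
    using that
  proof (induction k arbitrary: z)
    case 0
    then show ?case using zero by simp
  next
    case (Suc k)
    have "((deriv ^^ k) f has_real_derivative 0) (at z)"
      by (rule has_field_derivative_transform_within_open[where f = "\<lambda>_. 0" and S = "{y<..}"])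
        (use Suc in auto)
    then show ?case by (simp add: DERIV_imp_deriv)
  qed
  define b where "b = max x y + 1"
  have "(-1) ^ 0 * (deriv ^^ 0) f x = 0"
    by (rule alternating_derivatives_flat_imp_zero[where b = b])
      (use cm x y derivs[of b] in \<open>auto simp: b_def completely_monotone_def
         intro!: completely_monotone_has_derivative[simplified]\<close>)
  with x show False by simp
qed

lemma completely_monotone_measurable:
  assumes "completely_monotone f"
  shows "set_borel_measurable borel {0<..} f"
proof -
  have "f differentiable_on {0<..}"
    using assms unfolding completely_monotone_def smooth_on_pos_def by (metis funpow_0)
  then show ?thesis
    unfolding set_borel_measurable_def
    by (intro borel_measurable_continuous_on_indicator differentiable_imp_continuous_on) auto
qed

section \<open>Laplace transforms of decreasing functions\<close>

lemma nn_integral_exp_Ici: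
  assumes "0 < c"
  shows "(\<integral>\<^sup>+t\<in>{0..}. ennreal (exp (- t * c)) \<partial>lborel) = ennreal (1 / c)"
proof -
  have "(\<integral>\<^sup>+t. ennreal (exponential_density c t) \<partial>lborel) = 1"
    using prob_space.emeasure_space_1[OF prob_space_exponential_density[OF assms]]
    by (simp add: emeasure_density)
  moreover have "(\<integral>\<^sup>+t\<in>{0..}. ennreal (exp (- t * c)) \<partial>lborel)
     = (\<integral>\<^sup>+t. ennreal (1 / c) * ennreal (exponential_density c t) \<partial>lborel)"
    using assms by (intro nn_integral_cong)
      (auto simp: exponential_density_def indicator_def simp flip: ennreal_mult)
  ultimately show ?thesis by (simp add: nn_integral_cmult)
qed

definition laplace_transform :: "(real \<Rightarrow> real) \<Rightarrow> real \<Rightarrow> ennreal" where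
  "laplace_transform f x = (\<integral>\<^sup>+t\<in>{0<..}. ennreal (exp (- x * t) * f t) \<partial>lborel)"

text \<open>
  On \<open>(0, y]\<close> the kernel \<open>exp (- t / y)\<close> is at least \<open>exp (- 1)\<close>.
\<close>

lemma integral_le_laplace_transform:
  assumes nonneg: "\<And>t. 0 < t \<Longrightarrow> 0 \<le> f t" and y: "0 < y"
    and meas: "set_borel_measurable borel {0<..} f"
  shows "(\<integral>\<^sup>+t\<in>{0<..y}. ennreal (f t) \<partial>lborel) \<le> ennreal (exp 1) * laplace_transform f (1 / y)"
proof -
  have [measurable]: "(\<lambda>t. indicator {0<..} t * f t) \<in> borel_measurable borel"
    using meas by (simp add: set_borel_measurable_def)
  have eq: "ennreal (exp (- x * t) * f t) * indicator {0<..} t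
      = ennreal (exp (- x * t) * (indicator {0<..} t * f t))" for x t
    by (auto simp: indicator_def)
  have "(\<integral>\<^sup>+t\<in>{0<..y}. ennreal (f t) \<partial>lborel)
      \<le> (\<integral>\<^sup>+t. ennreal (exp 1) * (ennreal (exp (- (1 / y) * t) * f t) * indicator {0<..} t) \<partial>lborel)"
  proof (rule nn_integral_mono)
    fix t
    show "ennreal (f t) * indicator {0<..y} t
       \<le> ennreal (exp 1) * (ennreal (exp (- (1 / y) * t) * f t) * indicator {0<..} t)"
    proof (cases "t \<in> {0<..y}")
      case True
      then have "1 * f t \<le> (exp 1 * exp (- (1 / y) * t)) * f t"
        using nonneg y by (intro mult_right_mono) (auto simp: exp_add[symmetric] field_simps)
      then show ?thesis using True nonneg
        by (auto simp: ennreal_mult[symmetric] mult.assoc intro!: ennreal_leI)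
    qed auto
  qed
  also have "\<dots> = ennreal (exp 1) * laplace_transform f (1 / y)"
    unfolding laplace_transform_def eq by (intro nn_integral_cmult) measurable
  finally show ?thesis .
qed

text \<open>
  A decreasing function is at most its average over \<open>(0, y]\<close>: the upper half of the Tauberian
  estimate.
\<close>

lemma antimono_le_laplace_transform:
  assumes nonneg: "\<And>t. 0 < t \<Longrightarrow> 0 \<le> f t"
    and antimono: "\<And>s t. 0 < s \<Longrightarrow> s \<le> t \<Longrightarrow> f t \<le> f s"
    and meas: "set_borel_measurable borel {0<..} f" and y: "0 < y"
  shows "ennreal (y * f y) \<le> ennreal (exp 1) * laplace_transform f (1 / y)"
proof -
  have "ennreal (y * f y) = (\<integral>\<^sup>+t\<in>{0<..y}. ennreal (f y) \<partial>lborel)"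
    using y nonneg[of y] by (simp add: nn_integral_cmult_indicator ennreal_mult mult.commute)
  also have "\<dots> \<le> (\<integral>\<^sup>+t\<in>{0<..y}. ennreal (f t) \<partial>lborel)"
    using antimono by (intro nn_integral_mono) (auto simp: indicator_def intro: ennreal_leI)
  also have "\<dots> \<le> ennreal (exp 1) * laplace_transform f (1 / y)"
    by (rule integral_le_laplace_transform[OF nonneg y meas])
  finally show ?thesis .
qed

text \<open>
  The transform is split at \<open>y\<close>: before \<open>y\<close> the kernel is at most \<open>1\<close>, after \<open>y\<close> a decreasing \<open>f\<close> is
  at most \<open>f y\<close>. The split point \<open>y\<close> and the argument \<open>x\<close> are independent. The estimate bounds
  \<open>f y\<close> from below if \<open>x\<close> is so much smaller than \<open>1 / y\<close> that the first term on the right is only a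
  fraction of the left-hand side.
\<close>

lemma laplace_transform_le_antimono:
  assumes nonneg: "\<And>t. 0 < t \<Longrightarrow> 0 \<le> f t"
    and antimono: "\<And>s t. 0 < s \<Longrightarrow> s \<le> t \<Longrightarrow> f t \<le> f s"
    and meas: "set_borel_measurable borel {0<..} f" and y: "0 < y" and x: "0 < x"
  shows "laplace_transform f x \<le> ennreal (exp 1) * laplace_transform f (1 / y) + ennreal (f y / x)"
proof -
  have [measurable]: "(\<lambda>t. indicator {0<..} t * f t) \<in> borel_measurable borel"
    using meas by (simp add: set_borel_measurable_def)
  have eq: "ennreal (f t) * indicator {0<..y} t
      = ennreal (indicator {0<..} t * f t) * indicator {0<..y} t" for t
    by (auto simp: indicator_def)
  have [measurable]: "(\<lambda>t. ennreal (f t) * indicator {0<..y} t) \<in> borel_measurable borel"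
    unfolding eq by measurable
  have "laplace_transform f x \<le> (\<integral>\<^sup>+t. ennreal (f t) * indicator {0<..y} t
      + ennreal (f y) * (ennreal (exp (- t * x)) * indicator {0..} t) \<partial>lborel)"
    unfolding laplace_transform_def
  proof (rule nn_integral_mono)
    fix t
    consider "t \<le> 0" | "0 < t" "t \<le> y" | "y < t" by linarith
    then show "ennreal (exp (- x * t) * f t) * indicator {0<..} t
      \<le> ennreal (f t) * indicator {0<..y} t
         + ennreal (f y) * (ennreal (exp (- t * x)) * indicator {0..} t)"
    proof cases
      case 2
      have "exp (- x * t) * f t \<le> 1 * f t"
        using 2 x nonneg by (intro mult_right_mono) auto
      then have "ennreal (exp (- x * t) * f t) \<le> ennreal (f t)" by (auto intro: ennreal_leI)
      then show ?thesis using 2 by (auto intro: add_increasing2)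
    next
      case 3
      have "exp (- x * t) * f t \<le> f y * exp (- t * x)"
        using 3 y antimono[of y t] by (simp add: mult.commute)
      then show ?thesis using 3 y nonneg[of y]
        by (auto simp: ennreal_mult[symmetric] intro!: ennreal_leI)
    qed auto
  qed
  also have "\<dots> = (\<integral>\<^sup>+t\<in>{0<..y}. ennreal (f t) \<partial>lborel)
      + ennreal (f y) * (\<integral>\<^sup>+t\<in>{0..}. ennreal (exp (- t * x)) \<partial>lborel)"
    by (subst nn_integral_add) (auto simp: nn_integral_cmult)
  also have "ennreal (f y) * (\<integral>\<^sup>+t\<in>{0..}. ennreal (exp (- t * x)) \<partial>lborel) = ennreal (f y / x)"
    using nonneg[of y] y x by (simp only: nn_integral_exp_Ici ennreal_mult[symmetric]) 
      (simp add: ennreal_mult[symmetric])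
  finally show ?thesis
    using integral_le_laplace_transform[OF nonneg y meas] by (meson add_right_mono order_trans)
qed

section \<open>The Laplace transform of the potential density\<close>

lemma possibly_killed_subordinator_prob_space:
  "possibly_killed_subordinator M S \<Longrightarrow> prob_space M"
  by (auto simp: possibly_killed_subordinator_def subordinator_def levy_process_def)

text \<open>
  Killing preserves right-continuity: before \<open>\<zeta>\<close> the path is that of \<open>X\<close> for a short while longer,
  and from \<open>\<zeta>\<close> on it is constantly infinite.
\<close>

lemma possibly_killed_subordinator_right_continuous:
  assumes "possibly_killed_subordinator M S"
  shows "AE \<omega> in M. \<forall>t\<ge>0. ((\<lambda>s. S s \<omega>) \<longlongrightarrow> S t \<omega>) (at_right t)"
proof -
  obtain X \<zeta> where
    X: "AE \<omega> in M. \<forall>t\<ge>0. continuous (at_right t) (\<lambda>s. X s \<omega>)" and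
    S: "AE \<omega> in M. \<forall>t\<ge>0. S t \<omega> = (if ennreal t < \<zeta> \<omega> then ennreal (X t \<omega>) else \<infinity>)"
    using assms
    by (auto simp: possibly_killed_subordinator_def subordinator_def levy_process_def)
  show ?thesis
    using X S
  proof eventually_elim
    case (elim \<omega>)
    show ?case
    proof (intro allI impI)
      fix t :: real assume t: "0 \<le> t"
      have later: "\<forall>\<^sub>F s in at_right t. t < s" by (simp add: eventually_at_right_less)
      show "((\<lambda>s. S s \<omega>) \<longlongrightarrow> S t \<omega>) (at_right t)"
      proof (cases "ennreal t < \<zeta> \<omega>")
        case True
        have "((\<lambda>s. ennreal s) \<longlongrightarrow> ennreal t) (at_right t)" by (intro tendsto_intros)
        then have "\<forall>\<^sub>F s in at_right t. ennreal s < \<zeta> \<omega>" by (rule order_tendstoD) (rule True)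
        then have "\<forall>\<^sub>F s in at_right t. ennreal (X s \<omega>) = S s \<omega>"
          using later by eventually_elim (use elim t in auto)
        moreover have "((\<lambda>s. ennreal (X s \<omega>)) \<longlongrightarrow> ennreal (X t \<omega>)) (at_right t)"
          using elim t by (intro tendsto_ennrealI) (auto simp: continuous_within)
        ultimately show ?thesis using elim t True by (auto intro: Lim_transform_eventually)
      next
        case False
        have "\<forall>\<^sub>F s in at_right t. S t \<omega> = S s \<omega>"
          using later
        proof eventually_elim
          case (elim s)
          then have "\<not> ennreal s < \<zeta> \<omega>"
            using False t by (meson ennreal_leI le_less_trans less_imp_le)
          then show ?case using \<open>\<forall>t\<ge>0. S t \<omega> = _ t\<close> elim t False by auto
        qed
        then show ?thesis by (rule Lim_transform_eventually[OF tendsto_const])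
      qed
    qed
  qed
qed

text \<open>
  The potential measure integrates over time for each fixed path, the Laplace exponent integrates
  over paths for each fixed time. Exchanging the two requires joint measurability, which the
  process need not have on an exceptional null set of paths; hence the modification \<open>T\<close>. It is the
  limit of step processes that look up the path at the first multiple of \<open>1 / (n + 1)\<close> strictly
  after \<open>t\<close>.
\<close>

lemma right_continuous_jointly_measurable:
  fixes S :: "real \<Rightarrow> 'a \<Rightarrow> ennreal"
  assumes meas: "\<And>t. 0 \<le> t \<Longrightarrow> S t \<in> borel_measurable M"
    and rc: "AE \<omega> in M. \<forall>t\<ge>0. ((\<lambda>s. S s \<omega>) \<longlongrightarrow> S t \<omega>) (at_right t)"
  obtains T where "T \<in> borel_measurable (M \<Otimes>\<^sub>M lborel)"
    and "AE \<omega> in M. \<forall>t\<ge>0. T (\<omega>, t) = S t \<omega>"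
proof -
  \<comment> \<open>\<open>k n t\<close> is the index of the step that contains \<open>t\<close>, and \<open>r n i\<close> the right end point of step
    \<open>i\<close> of width \<open>1 / (n + 1)\<close>.\<close>
  define k where "k = (\<lambda>(n::nat) (t::real). nat \<lfloor>real (Suc n) * t\<rfloor>)"
  define r where "r = (\<lambda>(n::nat) (i::nat). real (Suc i) / real (Suc n))"
  \<comment> \<open>The lower limit, as the limit may fail to exist on a null set of paths.\<close>
  define T where "T = (\<lambda>(\<omega>, t). liminf (\<lambda>n. S (r n (k n t)) \<omega>))"
  have step: "(\<lambda>p. S (r n (k n (snd p))) (fst p)) \<in> borel_measurable (M \<Otimes>\<^sub>M lborel)" for n
  proof (rule measurable_compose_countable)
    fix i
    have [measurable]: "S (r n i) \<in> borel_measurable M" by (rule meas) (simp add: r_def)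
    show "(\<lambda>p. S (r n i) (fst p)) \<in> borel_measurable (M \<Otimes>\<^sub>M lborel)" by measurable
  next
    show "(\<lambda>p. k n (snd p)) \<in> M \<Otimes>\<^sub>M lborel \<rightarrow>\<^sub>M count_space UNIV"
      unfolding k_def by measurable
  qed
  have "T \<in> borel_measurable (M \<Otimes>\<^sub>M lborel)"
    using borel_measurable_liminf[OF step] by (simp add: T_def case_prod_beta')
  moreover have "AE \<omega> in M. \<forall>t\<ge>0. T (\<omega>, t) = S t \<omega>"
    using rc
  proof eventually_elim
    case (elim \<omega>)
    show ?case
    proof (intro allI impI)
      fix t :: real assume t: "0 \<le> t"
      have bounds: "t < r n (k n t)" "r n (k n t) \<le> t + 1 / real (Suc n)" for n
      proof -
        have "real (k n t) = real_of_int \<lfloor>real (Suc n) * t\<rfloor>"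
          using t by (simp add: k_def)
        then have "real (Suc n) * t < real (Suc (k n t))" "real (Suc (k n t)) \<le> real (Suc n) * t + 1"
          by linarith+
        then show "t < r n (k n t)" "r n (k n t) \<le> t + 1 / real (Suc n)"
          by (simp_all add: r_def field_simps del: of_nat_Suc)
      qed
      have "(\<lambda>n. r n (k n t)) \<longlonglongrightarrow> t"
      proof (rule tendsto_sandwich[of "\<lambda>_. t" _ _ "\<lambda>n. t + 1 / real (Suc n)"])
        show "(\<lambda>n. t + 1 / real (Suc n)) \<longlonglongrightarrow> t"
          using tendsto_add[OF tendsto_const LIMSEQ_Suc[OF lim_1_over_n], of t] by simp
      qed (use bounds in \<open>auto intro!: always_eventually less_imp_le\<close>)
      then have "filterlim (\<lambda>n. r n (k n t)) (at_right t) sequentially"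
        using bounds by (auto simp: filterlim_at intro!: always_eventually less_imp_neq[symmetric])
      then have "(\<lambda>n. S (r n (k n t)) \<omega>) \<longlonglongrightarrow> S t \<omega>"
        by (rule filterlim_compose[OF elim[rule_format, OF t]])
      then show "T (\<omega>, t) = S t \<omega>"
        by (simp add: T_def lim_imp_Liminf)
    qed
  qed
  ultimately show thesis by (rule that)
qed

text \<open>
  By Tonelli, the Laplace transform of the potential measure at \<open>x\<close> is
  \<open>\<integral> E (exp (- x * S t)) dt = \<integral> exp (- t * \<phi> x) dt = 1 / \<phi> x\<close>. The density \<open>u\<close> only sees the measure
  on \<open>(0, \<infinity>)\<close>, but there is no atom at \<open>0\<close>: such an atom would be a lower bound of \<open>1 / \<phi> y\<close> for
  all large \<open>y\<close>, while \<open>\<phi>\<close> is unbounded.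
\<close>

lemma laplace_transform_potential_density:
  assumes S: "possibly_killed_subordinator M S"
    and exponent: "laplace_exponent M S \<phi>"
    and unbounded: "filterlim \<phi> at_top at_top"
    and u: "potential_density M S u"
    and x: "0 < x" "0 < \<phi> x"
  shows "laplace_transform u x = ennreal (1 / \<phi> x)"
proof -
  interpret prob_space M using S by (rule possibly_killed_subordinator_prob_space)
  have S_meas: "S t \<in> borel_measurable M" if "0 \<le> t" for t
    using S that by (auto simp: possibly_killed_subordinator_def)
  obtain T where T [measurable]: "T \<in> borel_measurable (M \<Otimes>\<^sub>M lborel)"
    and T_eq: "AE \<omega> in M. \<forall>t\<ge>0. T (\<omega>, t) = S t \<omega>"
    by (rule right_continuous_jointly_measurable[OF S_meas
        possibly_killed_subordinator_right_continuous[OF S]])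
  interpret P: pair_sigma_finite M lborel ..
  have u_nonneg: "0 \<le> u t" if "0 < t" for t
    using u that by (auto simp: potential_density_def completely_monotone_nonneg)
  have [measurable]: "(\<lambda>t. indicator {0<..} t * u t) \<in> borel_measurable borel"
    using completely_monotone_measurable[of u] u
    by (simp add: potential_density_def set_borel_measurable_def)

  \<comment> \<open>The potential measure as the image of time times probability, with the killed part removed.\<close>
  define V where "V = distr (density (M \<Otimes>\<^sub>M lborel)
      (\<lambda>p. indicator {0..} (snd p) * indicator {..<\<infinity>} (T p))) borel (\<lambda>p. enn2real (T p))"
  have sets_V [measurable_cong]: "sets V = sets borel" by (simp add: V_def)
  have V: "(\<integral>\<^sup>+s. f s \<partial>V)
      = (\<integral>\<^sup>+p. indicator {0..} (snd p) * indicator {..<\<infinity>} (T p) * f (enn2real (T p)) \<partial>(M \<Otimes>\<^sub>M lborel))"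
    if [measurable]: "f \<in> borel_measurable borel" for f
    by (simp add: V_def nn_integral_distr nn_integral_density)

  have V_potential: "emeasure V A = potential_measure M S A" if [measurable]: "A \<in> sets borel" for A
  proof -
    have "emeasure V A = (\<integral>\<^sup>+s. indicator A s \<partial>V)" by simp
    also have "\<dots> = (\<integral>\<^sup>+p. indicator {0..} (snd p) * indicator {..<\<infinity>} (T p)
        * indicator A (enn2real (T p)) \<partial>(M \<Otimes>\<^sub>M lborel))"
      by (rule V) simp
    also have "\<dots> = (\<integral>\<^sup>+\<omega>. (\<integral>\<^sup>+t. indicator {0..} t * indicator {..<\<infinity>} (T (\<omega>, t))
        * indicator A (enn2real (T (\<omega>, t))) \<partial>lborel) \<partial>M)"
      by (subst lborel.nn_integral_fst[symmetric]) simp_all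
    also have "\<dots> = potential_measure M S A"
      unfolding potential_measure_def
    proof (rule nn_integral_cong_AE, use T_eq in eventually_elim)
      case (elim \<omega>)
      then show ?case
        by (intro nn_integral_cong) (auto simp: indicator_def less_top)
    qed
    finally show ?thesis .
  qed

  have V_exp: "(\<integral>\<^sup>+s. ennreal (exp (- y * s)) \<partial>V) = ennreal (1 / \<phi> y)" if y: "0 < y" "0 < \<phi> y" for y
  proof -
    have [measurable]: "exp_neg_mult y \<in> borel_measurable borel"
      unfolding exp_neg_mult_def by measurable
    have bounds: "0 \<le> exp_neg_mult y z" "exp_neg_mult y z \<le> 1" for z
      using y by (auto simp: exp_neg_mult_def)
    have "(\<integral>\<^sup>+s. ennreal (exp (- y * s)) \<partial>V)
      = (\<integral>\<^sup>+p. indicator {0..} (snd p) * ennreal (exp_neg_mult y (T p)) \<partial>(M \<Otimes>\<^sub>M lborel))"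
      by (subst V, measurable, intro nn_integral_cong)
        (auto simp: indicator_def exp_neg_mult_def less_top)
    also have "\<dots> = (\<integral>\<^sup>+t. (\<integral>\<^sup>+\<omega>. indicator {0..} t * ennreal (exp_neg_mult y (T (\<omega>, t))) \<partial>M) \<partial>lborel)"
      by (subst P.nn_integral_snd[symmetric]) simp_all
    also have "\<dots> = (\<integral>\<^sup>+t\<in>{0..}. ennreal (exp (- t * \<phi> y)) \<partial>lborel)"
    proof (rule nn_integral_cong)
      fix t :: real
      show "(\<integral>\<^sup>+\<omega>. indicator {0..} t * ennreal (exp_neg_mult y (T (\<omega>, t))) \<partial>M)
        = ennreal (exp (- t * \<phi> y)) * indicator {0..} t"
      proof (cases "0 \<le> t")
        case True
        note [measurable] = S_meas[OF True]
        have "(\<integral>\<^sup>+\<omega>. ennreal (exp_neg_mult y (T (\<omega>, t))) \<partial>M) 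
            = (\<integral>\<^sup>+\<omega>. ennreal (exp_neg_mult y (S t \<omega>)) \<partial>M)"
          by (rule nn_integral_cong_AE, use T_eq in eventually_elim) (simp add: True)
        also have "\<dots> = ennreal (\<integral>\<omega>. exp_neg_mult y (S t \<omega>) \<partial>M)"
          using bounds by (intro nn_integral_eq_integral integrable_const_bound[of _ 1]) auto
        also have "\<dots> = ennreal (exp (- t * \<phi> y))"
          using exponent True y by (simp add: laplace_exponent_def)
        finally show ?thesis using True by simp
      qed simp
    qed
    also have "\<dots> = ennreal (1 / \<phi> y)" using y by (intro nn_integral_exp_Ici)
    finally show ?thesis .
  qed

  have V_atMost_0: "emeasure V {..0} = 0"
  proof -
    have "\<forall>\<^sub>F y in at_top. emeasure V {..0} \<le> ennreal (1 / \<phi> y)"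
      using eventually_gt_at_top[of 0] filterlim_at_top_dense[THEN iffD1, OF unbounded, rule_format, of 0]
    proof eventually_elim
      case (elim y)
      \<comment> \<open>The exponential \<open>exp (- y * s)\<close> is at least \<open>1\<close> for \<open>s \<le> 0\<close>.\<close>
      have "emeasure V {..0} = (\<integral>\<^sup>+s. indicator {..0} s \<partial>V)"
        by (simp add: sets_V)
      also have "\<dots> \<le> (\<integral>\<^sup>+s. ennreal (exp (- y * s)) \<partial>V)"
        using elim
        by (intro nn_integral_mono) (auto simp: indicator_def mult_nonneg_nonpos simp flip: ennreal_1 intro!: ennreal_leI)
      finally show ?case using V_exp elim by simp
    qed
    moreover have "((\<lambda>y. ennreal (1 / \<phi> y)) \<longlongrightarrow> ennreal 0) at_top"
      using tendsto_divide_0[OF tendsto_const filterlim_at_top_imp_at_infinity[OF unbounded]]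
      by (intro tendsto_ennrealI)
    ultimately have "emeasure V {..0} \<le> ennreal 0"
      by (intro tendsto_lowerbound) auto
    then show ?thesis by simp
  qed

  have "density V (indicator {0<..}) = density lborel (\<lambda>s. ennreal (indicator {0<..} s * u s))"
  proof (rule measure_eqI)
    fix A assume "A \<in> sets (density V (indicator {0<..}))"
    then have A [measurable]: "A \<in> sets borel" by (simp add: sets_V)
    have "emeasure (density V (indicator {0<..})) A = (\<integral>\<^sup>+s\<in>A. indicator {0<..} s \<partial>V)"
      by (rule emeasure_density) (simp_all add: sets_V)
    also have "\<dots> = (\<integral>\<^sup>+s. indicator (A \<inter> {0<..}) s \<partial>V)"
      by (intro nn_integral_cong) (auto simp: indicator_def)
    also have "\<dots> = potential_measure M S (A \<inter> {0<..})"
      by (simp add: V_potential)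
    also have "\<dots> = (\<integral>\<^sup>+s\<in>A \<inter> {0<..}. ennreal (u s) \<partial>lborel)"
      using u A by (simp add: potential_density_def)
    also have "\<dots> = (\<integral>\<^sup>+s\<in>A. ennreal (indicator {0<..} s * u s) \<partial>lborel)"
      by (intro nn_integral_cong) (auto simp: indicator_def)
    also have "\<dots> = emeasure (density lborel (\<lambda>s. ennreal (indicator {0<..} s * u s))) A"
      by (subst emeasure_density) simp_all
    finally show "emeasure (density V (indicator {0<..})) A
        = emeasure (density lborel (\<lambda>s. ennreal (indicator {0<..} s * u s))) A" .
  qed (simp add: sets_V)
  then have "(\<integral>\<^sup>+s. ennreal (exp (- x * s)) \<partial>density V (indicator {0<..}))
      = (\<integral>\<^sup>+s. ennreal (exp (- x * s)) \<partial>density lborel (\<lambda>s. ennreal (indicator {0<..} s * u s)))"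
    by simp
  also have "\<dots> = laplace_transform u x"
    unfolding laplace_transform_def
    by (subst nn_integral_density, measurable, intro nn_integral_cong)
      (auto simp: indicator_def u_nonneg mult.commute simp flip: ennreal_mult)
  also have "(\<integral>\<^sup>+s. ennreal (exp (- x * s)) \<partial>density V (indicator {0<..}))
      = (\<integral>\<^sup>+s. ennreal (exp (- x * s)) \<partial>V)"
  proof (subst nn_integral_density, measurable, rule nn_integral_cong_AE)
    have "AE s in V. s \<notin> {..0}" using V_atMost_0 by (intro AE_not_in) (auto simp: null_sets_def sets_V)
    then show "AE s in V. indicator {0<..} s * ennreal (exp (- x * s)) = ennreal (exp (- x * s))"
      by eventually_elim (auto simp: indicator_def)
  qed
  finally show ?thesis using V_exp x by simp
qed

section \<open>Regular variation\<close>

text \<open>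
  Where \<open>\<phi>\<close> is comparable to \<open>x powr a * l x\<close> with index \<open>a > 0\<close>, the ratio \<open>\<phi> (d * x) / \<phi> x\<close> is at
  most \<open>c\<^sup>2 * d powr a\<close> times \<open>l (d * x) / l x\<close>, which tends to \<open>1\<close>. The factor \<open>d powr a\<close> can be made
  as small as desired. It is fixed before \<open>x\<close>, so that pointwise convergence of \<open>l (d * x) / l x\<close>
  provides \<open>N\<close>. The condition \<open>1 \<le> d * N\<close> keeps \<open>d * x\<close> in the range of the
  comparison.
\<close>

lemma regularly_varying_small_ratio:
  assumes l: "\<And>t. 0 < t \<Longrightarrow> 0 < l t" "slowly_varying l"
    and a: "0 < a" and c: "0 < c"
    and comp: "\<And>x. 1 \<le> x \<Longrightarrow> inverse c \<le> \<phi> x / (x powr a * l x) \<and> \<phi> x / (x powr a * l x) \<le> c"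
    and k: "0 < k"
  obtains d N where "0 < d" "1 \<le> N" "1 \<le> d * N" "\<And>x. N \<le> x \<Longrightarrow> k * \<phi> (d * x) \<le> \<phi> x"
proof -
  \<comment> \<open>The factor \<open>2\<close> makes up for \<open>l (d * x) / l x\<close>, which is eventually less than \<open>2\<close>.\<close>
  define d where "d = (1 / (2 * k * c\<^sup>2)) powr (1 / a)"
  have d: "0 < d" "d powr a * (2 * k * c\<^sup>2) = 1"
    using a c k by (simp_all add: d_def powr_powr)
  have "((\<lambda>x. l (d * x) / l x) \<longlongrightarrow> 1) at_top"
    using l(2) d by (simp add: slowly_varying_def)
  then have "\<forall>\<^sub>F x in at_top. l (d * x) / l x < 2" by (rule order_tendstoD) simp
  then obtain N0 where N0: "\<And>x. N0 \<le> x \<Longrightarrow> l (d * x) / l x < 2"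
    by (auto simp: eventually_at_top_linorder)
  define N where "N = max (max 1 N0) (1 / d)"
  have "1 / d \<le> N" by (simp add: N_def)
  then have dN: "1 \<le> d * N" using d by (simp add: field_simps)
  have "k * \<phi> (d * x) \<le> \<phi> x" if x: "N \<le> x" for x
  proof -
    have x1: "1 \<le> x" "N0 \<le> x" using x by (auto simp: N_def)
    have dx: "1 \<le> d * x" using dN x d by (meson less_imp_le mult_left_mono order_trans)
    have lx: "0 < l x" "0 < l (d * x)" using l x1 dx d by auto
    have "\<phi> (d * x) \<le> c * ((d * x) powr a * l (d * x))"
      using conjunct2[OF comp[OF dx]] lx d x1 by (subst (asm) pos_divide_le_eq) auto
    also have "\<dots> \<le> c * ((d powr a * x powr a) * (2 * l x))"
      using N0[OF x1(2)] lx c d x1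
      by (intro mult_left_mono) (auto simp: powr_mult field_simps)
    finally have "k * \<phi> (d * x) \<le> k * (c * ((d powr a * x powr a) * (2 * l x)))"
      using k by simp
    also have "\<dots> = (d powr a * (2 * k * c\<^sup>2)) * (inverse c * (x powr a * l x))"
      using c by (simp add: field_simps power2_eq_square)
    also have "\<dots> = inverse c * (x powr a * l x)" using d by simp
    also have "\<dots> \<le> \<phi> x"
      using comp[OF x1(1)] lx x1 by (simp add: pos_le_divide_eq)
    finally show ?thesis .
  qed
  then show thesis using d dN by (intro that[of d N]) (auto simp: N_def)
qed

section \<open>Bounds for the potential density\<close>

lemma potential_density_pos:
  assumes S: "possibly_killed_subordinator M S"
    and exponent: "laplace_exponent M S \<phi>"
    and unbounded: "filterlim \<phi> at_top at_top"
    and u: "potential_density M S u" and t: "0 < t"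
  shows "0 < u t"
proof (rule ccontr)
  assume "\<not> 0 < u t"
  have cm: "completely_monotone u" using u by (simp add: potential_density_def)
  have zero: "u s = 0" if "0 < s" for s
  proof -
    have "\<not> 0 < u s"
      using completely_monotone_pos[OF cm that _ t] \<open>\<not> 0 < u t\<close> by blast
    then show ?thesis using completely_monotone_nonneg[OF cm that] by simp
  qed
  have "\<forall>\<^sub>F x in at_top. 0 < x \<and> 0 < \<phi> x"
    using filterlim_at_top_dense[THEN iffD1, OF unbounded] eventually_gt_at_top
    by (intro eventually_conj) auto
  then obtain x where x: "0 < x" "0 < \<phi> x"
    using eventually_happens'[OF trivial_limit_at_top_linorder] by blast
  have "laplace_transform u x = (\<integral>\<^sup>+t. 0 \<partial>(lborel :: real measure))"
    unfolding laplace_transform_def using zero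
    by (intro nn_integral_cong) (auto simp: indicator_def)
  then show False
    using laplace_transform_potential_density[OF S exponent unbounded u x] x by simp
qed

lemma potential_density_upper:
  assumes "possibly_killed_subordinator M S" "laplace_exponent M S \<phi>"
    "filterlim \<phi> at_top at_top" and u: "potential_density M S u"
    and t: "0 < t" and pos: "0 < \<phi> (1 / t)"
  shows "t * \<phi> (1 / t) * u t \<le> exp 1"
proof -
  have cm: "completely_monotone u" using u by (simp add: potential_density_def)
  have "ennreal (t * u t) \<le> ennreal (exp 1) * laplace_transform u (1 / t)"
    by (rule antimono_le_laplace_transform)
      (use cm t in \<open>auto intro: completely_monotone_nonneg completely_monotone_antimono
         completely_monotone_measurable\<close>)
  also have "laplace_transform u (1 / t) = ennreal (1 / \<phi> (1 / t))"
    by (rule laplace_transform_potential_density[OF assms(1-4)]) (use t pos in auto)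
  also have "ennreal (exp 1) * ennreal (1 / \<phi> (1 / t)) = ennreal (exp 1 / \<phi> (1 / t))"
    using pos by (simp add: ennreal_mult[symmetric])
  finally have "t * u t \<le> exp 1 / \<phi> (1 / t)"
    using pos by (simp add: ennreal_le_iff)
  then show ?thesis using pos by (simp add: field_simps)
qed

text \<open>
  With \<open>x = d / t\<close>, splitting the transform at \<open>t\<close> gives
  \<open>1 / \<phi> x \<le> exp 1 / \<phi> (1 / t) + u t / x\<close>. If \<open>1 / \<phi> x\<close> is at least twice the first term on the right,
  that term can be absorbed into the left-hand side.
\<close>

lemma potential_density_lower:
  assumes "possibly_killed_subordinator M S" "laplace_exponent M S \<phi>"
    "filterlim \<phi> at_top at_top" and u: "potential_density M S u"
    and t: "0 < t" and d: "0 < d"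
    and pos: "0 < \<phi> (1 / t)" "0 < \<phi> (d * (1 / t))"
    and le: "2 * exp 1 * \<phi> (d * (1 / t)) \<le> \<phi> (1 / t)"
  shows "d \<le> t * \<phi> (1 / t) * u t"
proof -
  have cm: "completely_monotone u" using u by (simp add: potential_density_def)
  have ut: "0 \<le> u t" using cm t by (rule completely_monotone_nonneg)
  define x where "x = d * (1 / t)"
  have x: "0 < x" using d t by (simp add: x_def)
  have "laplace_transform u x
      \<le> ennreal (exp 1) * laplace_transform u (1 / t) + ennreal (u t / x)"
    by (rule laplace_transform_le_antimono)
      (use cm t x in \<open>auto intro: completely_monotone_nonneg completely_monotone_antimono
         completely_monotone_measurable\<close>)
  also have "laplace_transform u (1 / t) = ennreal (1 / \<phi> (1 / t))"
    by (rule laplace_transform_potential_density[OF assms(1-4)]) (use t pos in auto)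
  also have "laplace_transform u x = ennreal (1 / \<phi> x)"
    by (rule laplace_transform_potential_density[OF assms(1-4) x]) (use pos in \<open>simp add: x_def\<close>)
  also have "ennreal (exp 1) * ennreal (1 / \<phi> (1 / t)) + ennreal (u t / x)
      = ennreal (exp 1 / \<phi> (1 / t) + u t / x)"
    using pos ut x by (simp add: ennreal_mult[symmetric] ennreal_plus[symmetric] del: ennreal_plus)
  finally have "1 / \<phi> x \<le> exp 1 / \<phi> (1 / t) + u t / x"
    using pos ut x by (subst (asm) ennreal_le_iff) auto
  moreover have "2 * exp 1 / \<phi> (1 / t) \<le> 1 / \<phi> x"
    using le pos by (simp add: x_def field_simps)
  ultimately have "exp 1 / \<phi> (1 / t) \<le> u t / x" by simp
  then have "exp 1 * x \<le> u t * \<phi> (1 / t)" using pos x by (simp add: field_simps)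
  then have "exp 1 * d \<le> t * \<phi> (1 / t) * u t" using t by (simp add: x_def field_simps)
  moreover have "1 * d \<le> exp 1 * d" using d by (intro mult_right_mono) auto
  ultimately show ?thesis by simp
qed

theorem theorem2p9:
  fixes M :: "'a measure" and S :: "real \<Rightarrow> 'a \<Rightarrow> ennreal"
    and \<phi> u l :: "real \<Rightarrow> real" and \<alpha> :: real
  assumes "possibly_killed_subordinator M S"
    and "laplace_exponent M S \<phi>"
    and "complete_bernstein_function \<phi>"
    and "no_drift \<phi>"
    and "filterlim \<phi> at_top at_top"
    and "potential_density M S u"
    and "0 < \<alpha>" and "\<alpha> < 2"
    and "l \<in> borel_measurable (restrict_space borel {0<..})"
    and "\<And>t. 0 < t \<Longrightarrow> 0 < l t"
    and "locally_bounded_above_below l"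
    and "slowly_varying l"
    and "comparable_at_infinity \<phi> (\<lambda>x. x powr (\<alpha> / 2) * l x)"
  shows "comparable_at_zero u (\<lambda>t. inverse t * inverse (\<phi> (inverse t)))
    \<and> comparable_at_zero (\<lambda>t. inverse t * inverse (\<phi> (inverse t)))
        (\<lambda>t. t powr (\<alpha> / 2 - 1) / l (inverse t))"
proof
  note S = assms(1,2,5,6)
  have l_pos: "0 < l t" if "0 < t" for t using assms(10) that .
  define w where "w = (\<lambda>x. x powr (\<alpha> / 2) * l x)"
  have w_pos: "0 < w x" if "1 \<le> x" for x
    using that l_pos[of x] by (simp add: w_def)
  obtain c where c: "1 < c"
    and comp: "\<And>x. 1 \<le> x \<Longrightarrow> inverse c \<le> \<phi> x / w x \<and> \<phi> x / w x \<le> c"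
    using assms(13) by (auto simp: comparable_on_def w_def)
  have lower: "inverse c * w x \<le> \<phi> x" if "1 \<le> x" for x
    using comp[OF that] w_pos[OF that] by (simp add: pos_le_divide_eq)
  have \<phi>_pos: "0 < \<phi> x" if "1 \<le> x" for x
    using c w_pos[OF that] by (intro less_le_trans[OF _ lower[OF that]]) auto
  \<comment> \<open>The factor \<open>2 * exp 1\<close> is the one required for the absorption in the lower bound.\<close>
  obtain d N where d: "0 < d" and N: "1 \<le> N" "1 \<le> d * N"
    and scale: "\<And>x. N \<le> x \<Longrightarrow> 2 * exp 1 * \<phi> (d * x) \<le> \<phi> x"
    by (rule regularly_varying_small_ratio[of l "\<alpha> / 2" c \<phi> "2 * exp 1"])
      (use assms c comp in \<open>auto simp: w_def\<close>)
  obtain m where m: "0 < m" and m_le: "\<And>x. x \<in> {1..N} \<Longrightarrow> m \<le> l x"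
  proof -
    have "compact {1..N}" "{1..N} \<subseteq> {0<..}" by auto
    then show thesis using assms(11) that by (metis locally_bounded_above_below_def)
  qed
  have u1: "0 < u 1" by (rule potential_density_pos[OF S]) simp
  \<comment> \<open>For \<open>t\<close> in \<open>[1 / N, 1]\<close> each of the factors \<open>t\<close>, \<open>\<phi> (1 / t)\<close> and \<open>u t\<close> is bounded away from zero; \<open>b\<close> is
    the product of these bounds.\<close>
  define b where "b = inverse N * (inverse c * m) * u 1"
  have b: "0 < b" using N c m u1 by (simp add: b_def)
  have bound: "min d b \<le> t * \<phi> (1 / t) * u t" if t: "0 < t" "t \<le> 1" for t
  proof (cases "N \<le> 1 / t")
    case True
    have "d * N \<le> d * (1 / t)" using True d by (intro mult_left_mono) auto
    then have 1: "1 \<le> d * (1 / t)" "1 \<le> 1 / t" using N True by linarith+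
    have "d \<le> t * \<phi> (1 / t) * u t"
      by (intro potential_density_lower[OF S] \<phi>_pos scale d t True 1)
    then show ?thesis by simp
  next
    case False
    have 1: "inverse N \<le> t" using False t N by (simp add: field_simps)
    have t1: "1 \<le> 1 / t" using t by simp
    have "1 * m \<le> w (1 / t)"
      unfolding w_def using t1 False m m_le[of "1 / t"] assms(7)
      by (intro mult_mono ge_one_powr_ge_zero) auto
    then have "inverse c * m \<le> inverse c * w (1 / t)"
      using c by (intro mult_left_mono) auto
    with lower[OF t1] have 2: "inverse c * m \<le> \<phi> (1 / t)" by linarith
    have 3: "u 1 \<le> u t"
      using assms(6) t by (auto simp: potential_density_def intro: completely_monotone_antimono)
    have "b \<le> t * \<phi> (1 / t) * u t"
      unfolding b_def using 1 2 3 t N c m u1 \<phi>_pos[OF t1]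
      by (intro mult_mono) auto
    then show ?thesis by simp
  qed
  define C where "C = exp 1 + inverse (min d b)"
  have "0 < inverse (min d b)" "1 < exp (1::real)" using d b by simp_all
  then have "exp 1 \<le> C" "inverse (min d b) \<le> C" "1 < C"
    unfolding C_def by linarith+
  moreover have "inverse C \<le> min d b"
    using \<open>inverse (min d b) \<le> C\<close> d b
    by (metis inverse_inverse_eq le_imp_inverse_le min_less_iff_conj positive_imp_inverse_positive)
  ultimately show "comparable_at_zero u (\<lambda>t. inverse t * inverse (\<phi> (inverse t)))"
    unfolding comparable_on_def
  proof (intro exI[of _ C] conjI ballI)
    fix t :: real assume "t \<in> {0<..1}"
    then have t: "0 < t" "t \<le> 1" "0 < \<phi> (1 / t)" by (auto intro: \<phi>_pos)
    have eq: "u t / (inverse t * inverse (\<phi> (inverse t))) = t * \<phi> (1 / t) * u t"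
      using t by (simp add: field_simps)
    show "inverse C \<le> u t / (inverse t * inverse (\<phi> (inverse t)))"
      unfolding eq using bound[OF t(1,2)] \<open>inverse C \<le> min d b\<close> by linarith
    show "u t / (inverse t * inverse (\<phi> (inverse t))) \<le> C"
      unfolding eq using potential_density_upper[OF S t(1,3)] \<open>exp 1 \<le> C\<close> by linarith
  qed
  show "comparable_at_zero (\<lambda>t. inverse t * inverse (\<phi> (inverse t)))
        (\<lambda>t. t powr (\<alpha> / 2 - 1) / l (inverse t))"
    unfolding comparable_on_def
  proof (intro exI[of _ c] conjI ballI c)
    fix t :: real assume "t \<in> {0<..1}"
    then have t: "0 < t" "1 \<le> inverse t" by (auto simp: one_le_inverse)
    have shift: "t powr (a - 1) = inverse t * inverse (inverse t powr a)" for a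
      unfolding inverse_powr using t(1) by (simp add: powr_diff divide_inverse)
    have cancel: "inverse t * inverse f / (inverse t * inverse p / y) = inverse (f / (p * y))"
      for f p y
      using t(1) by (simp add: field_simps)
    have eq: "inverse t * inverse (\<phi> (inverse t)) / (t powr (\<alpha> / 2 - 1) / l (inverse t))
        = inverse (\<phi> (inverse t) / w (inverse t))"
      unfolding w_def shift cancel ..
    define q where "q = \<phi> (inverse t) / w (inverse t)"
    have q: "0 < q" "inverse c \<le> q" "q \<le> c"
      using \<phi>_pos[OF t(2)] w_pos[OF t(2)] comp[OF t(2)] by (simp_all add: q_def)
    show "inverse c \<le> inverse t * inverse (\<phi> (inverse t)) / (t powr (\<alpha> / 2 - 1) / l (inverse t))"
      unfolding eq q_def[symmetric] using le_imp_inverse_le[OF q(3,1)] .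
    show "inverse t * inverse (\<phi> (inverse t)) / (t powr (\<alpha> / 2 - 1) / l (inverse t)) \<le> c"
      unfolding eq q_def[symmetric] using le_imp_inverse_le[OF q(2)] c by simp
  qed
qed

end
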